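(* Let $\mu$ be a singular cardinal of countable cofinality, let $S$ be a stationary subset of $\mu^+$ consisting of ordinals of countable cofinality, and let $\langle c_\delta:\delta\in S\rangle$ be such that each $c_\delta$ is an increasing function from $\omega$ onto a cofinal subset of $\delta$ and for every closed unbounded $E\subseteq\mu^+$ there are stationarily many $\delta\in S$ with $c_\delta(n)\in E$ for all $n$. Let $\langle\mu_m:m<\omega\rangle$ be an increasing sequence of regular cardinals cofinal in $\mu$, and $\langle\cdot,\cdot\rangle:\omega\times\omega\rightarrow\omega$ a bijection increasing in each coordinate. For $\delta\in S$ and $m,n<\omega$ put $\mathrm{Int}_\delta(m,n)=(c_\delta(\langle m,n\rangle),c_\delta(\langle m,n\rangle+1))$ (open interval of ordinals). Let $\langle C_\delta:\delta\in S\rangle$ satisfy: each $C_\delta$ is closed unbounded in $\delta$; $\mathrm{ran}(c_\delta)\subseteq C_\delta$; $|C_\delta\cap(c_\delta(\langle m,n\rangle),c_\delta(\langle m,n\rangle+1)]|\leq\mu_m$ for all $m,n$; every element of $\mathrm{nacc}(C_\delta)\cap\mathrm{Int}_\delta(m,n)$ has cofinality $>\mu_m$; and for every club $E\subseteq\mu^+$ there are stationarily many $\delta\in S$ with $E\cap\mathrm{nacc}(C_\delta)\cap\mathrm{Int}_\delta(m,n)\neq\emptyset$ for all $m,n<\omega$. For $\delta\in S$ define $I_\delta$ as the family of all $A\subseteq C_\delta$ such that for all but finitely many $m<\omega$, for all but finitely many $n<\omega$, $A\cap\mathrm{nacc}(C_\delta)\cap\mathrm{Int}_\delta(m,n)=\emptyset$.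 Define $I$ as the family of all $A\subseteq\mu^+$ for which there is a closed unbounded $E\subseteq\mu^+$ such that $A\cap E\cap C_\delta\in I_\delta$ for every $\delta\in E\cap S$. Then: (1) each $I_\delta$ is an ideal on $C_\delta$ which is $\sigma$-indecomposable for every uncountable regular cardinal $\sigma$; (2) $I$ is a non-trivial (proper) ideal on $\mu^+$ containing every non-stationary subset of $\mu^+$, and $I$ is $\sigma$-indecomposable for every uncountable regular cardinal $\sigma<\mu$.
   Context: $\mathrm{nacc}(C)$ denotes the set of non-accumulation points of a set of ordinals $C$, i.e. those $\alpha\in C$ with $C\cap\alpha$ not cofinal in $\alpha$. An ideal on a set $X$ is a nonempty family of subsets of $X$ closed under subsets and finite unions. For a regular cardinal $\sigma$, an ideal is $\sigma$-indecomposable if it is closed under unions of $\subseteq$-increasing sequences of length $\sigma$ of its members. *)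

theory Defs
  imports Main "HOL-Library.Infinite_Set"
begin

unbundle cardinal_syntax

text \<open>
  Cardinals are the library's cardinal orders, compared by \<open>=o\<close>, \<open>\<le>o\<close>, \<open><o\<close>.
  The ordinals below \<open>\<mu>\<^sup>+\<close> are the elements of a type of class \<open>wellorder\<close> whose order has
  type \<open>cardSuc \<mu>\<close>. As with von Neumann ordinals, an ordinal \<open>\<delta>\<close> of this type is also identified
  with its set of predecessors \<open>{..<\<delta>}\<close>, and \<open>\<mu>\<^sup>+\<close> itself with \<open>UNIV\<close>; the argument \<open>X\<close> below
  is such an initial segment.
\<close>

definition ord_rel :: "'a::wellorder set \<Rightarrow> 'a rel" where
  "ord_rel X = {(x, y). x \<in> X \<and> y \<in> X \<and> x \<le> y}"

lemma Field_ord_rel [simp]: "Field (ord_rel X) = X"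
  by (auto simp: ord_rel_def Field_def)

text \<open>
  The library's \<^const>\<open>cofinal\<close> is strict (every point is exceeded), so it never holds for a
  successor ordinal. Cofinality is taken with the non-strict variant: successors have cofinality
  1, zero has cofinality 0, and the two variants agree on limit ordinals.
\<close>

definition weakly_cofinal :: "'a set \<Rightarrow> 'a rel \<Rightarrow> bool" where
  "weakly_cofinal A r \<longleftrightarrow> A \<subseteq> Field r \<and> (\<forall>a\<in>Field r. \<exists>b\<in>A. (a, b) \<in> r)"

definition cofinality :: "'a rel \<Rightarrow> 'a rel" where
  "cofinality r =
    card_of (SOME A. weakly_cofinal A r \<and> (\<forall>B. weakly_cofinal B r \<longrightarrow> |A| \<le>o |B| ))"

lemma cofinality_attained:
  assumes "Well_order r"
  obtains A where "weakly_cofinal A r" and "cofinality r = |A|"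
    and "\<And>B. weakly_cofinal B r \<Longrightarrow> |A| \<le>o |B|"
proof -
  let ?P = "\<lambda>A. weakly_cofinal A r \<and> (\<forall>B. weakly_cofinal B r \<longrightarrow> |A| \<le>o |B| )"
  let ?R = "{ |A| | A. weakly_cofinal A r}"
  have "refl_on (Field r) r"
    using assms by (simp add: order_on_defs)
  then have "weakly_cofinal (Field r) r"
    unfolding weakly_cofinal_def by (auto dest: refl_onD)
  then have "?R \<noteq> {}" by blast
  moreover have "\<forall>s\<in>?R. Card_order s" by (auto intro: card_of_Card_order)
  ultimately have "\<exists>s\<in>?R. \<forall>s'\<in>?R. s \<le>o s'"
    by (rule exists_minim_Card_order)
  then have "\<exists>A. ?P A" by blast
  then have "?P (SOME A. ?P A)" by (rule someI_ex)
  then show thesis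
    using that[of "SOME A. ?P A"] unfolding cofinality_def by blast
qed

definition club :: "'a::wellorder set \<Rightarrow> 'a set \<Rightarrow> bool" where
  "club X E \<longleftrightarrow> E \<subseteq> X \<and> cofinal E (ord_rel X) \<and>
     (\<forall>\<alpha>\<in>X. {..<\<alpha>} \<noteq> {} \<and> cofinal (E \<inter> {..<\<alpha>}) (ord_rel {..<\<alpha>}) \<longrightarrow> \<alpha> \<in> E)"

definition stationary :: "'a::wellorder set \<Rightarrow> bool" where
  "stationary T \<longleftrightarrow> (\<forall>E. club UNIV E \<longrightarrow> T \<inter> E \<noteq> {})"

text \<open>
  By strictness of \<^const>\<open>cofinal\<close>, accumulation points are understood in the usual sense
  \<open>\<alpha> = sup (C \<inter> \<alpha>)\<close>; in particular every successor element of \<open>C\<close> belongs to \<open>nacc C\<close>.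
\<close>

definition nacc :: "'a::wellorder set \<Rightarrow> 'a set" where
  "nacc C = {\<alpha> \<in> C. \<not> cofinal (C \<inter> {..<\<alpha>}) (ord_rel {..<\<alpha>})}"

definition Intv ::
  "(nat \<times> nat \<Rightarrow> nat) \<Rightarrow> ('a::wellorder \<Rightarrow> nat \<Rightarrow> 'a) \<Rightarrow> 'a \<Rightarrow> nat \<Rightarrow> nat \<Rightarrow> 'a set" where
  "Intv pr c \<delta> m n = {c \<delta> (pr (m, n)) <..< c \<delta> (pr (m, n) + 1)}"

definition ideal_on :: "'a set \<Rightarrow> 'a set set \<Rightarrow> bool" where
  "ideal_on X J \<longleftrightarrow> J \<noteq> {} \<and> J \<subseteq> Pow X \<and>
     (\<forall>A\<in>J. \<forall>B. B \<subseteq> A \<longrightarrow> B \<in> J) \<and> (\<forall>A\<in>J. \<forall>B\<in>J. A \<union> B \<in> J)"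

definition indecomposable :: "'d rel \<Rightarrow> 'a set set \<Rightarrow> bool" where
  "indecomposable \<sigma> J \<longleftrightarrow>
     (\<forall>A. relChain \<sigma> A \<and> (\<forall>i\<in>Field \<sigma>. A i \<in> J) \<longrightarrow> (\<Union>i\<in>Field \<sigma>. A i) \<in> J)"

definition I_at ::
  "(nat \<times> nat \<Rightarrow> nat) \<Rightarrow> ('a::wellorder \<Rightarrow> nat \<Rightarrow> 'a) \<Rightarrow> ('a \<Rightarrow> 'a set) \<Rightarrow> 'a \<Rightarrow> 'a set set" where
  "I_at pr c C \<delta> =
     {A. A \<subseteq> C \<delta> \<and>
         (\<forall>\<^sub>\<infinity>m. \<forall>\<^sub>\<infinity>n. A \<inter> nacc (C \<delta>) \<inter> Intv pr c \<delta> m n = {})}"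

definition I_global ::
  "(nat \<times> nat \<Rightarrow> nat) \<Rightarrow> 'a::wellorder set \<Rightarrow> ('a \<Rightarrow> nat \<Rightarrow> 'a) \<Rightarrow> ('a \<Rightarrow> 'a set) \<Rightarrow> 'a set set" where
  "I_global pr S c C =
     {A. \<exists>E. club UNIV E \<and> (\<forall>\<delta>\<in>E \<inter> S. A \<inter> E \<inter> C \<delta> \<in> I_at pr c C \<delta>)}"

end

theory Submission
  imports Defs
begin

text \<open>
  That a set lies in \<^term>\<open>I_at pr c C \<delta>\<close> is witnessed by natural numbers, and a witness for a
  set also serves its subsets. Along an increasing chain of uncountable regular length, a witness
  that fails does so from some point on; if every natural number failed, the countably many failure
  points would be bounded, and a set beyond the bound would have no witness. So one witness serves
  the whole chain. For the global ideal, intersect the \<open>\<sigma> < \<mu>\<close> many clubs that witness membership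
  of the chain's members; the result is again a club of \<open>\<mu>\<^sup>+\<close> by regularity of \<open>\<mu>\<^sup>+\<close>, and the
  local statement applies at each of its points.
\<close>

section \<open>Bounding small sets and uniformizing thresholds along regular cardinals\<close>

lemma regularCard_bounded:
  assumes "Card_order r" "regularCard r" "K \<subseteq> Field r" "|K| <o r"
  obtains b where "b \<in> Field r" "\<And>k. k \<in> K \<Longrightarrow> (k, b) \<in> r"
proof -
  have "\<not> cofinal K r"
    using assms not_ordLess_ordIso unfolding regularCard_def by blast
  \<comment> \<open>The library's \<open>cofinal\<close> asks for strictly larger elements, so its
    failure yields a \<open>b\<close> that no element of \<open>K\<close> strictly exceeds; totality
    then makes \<open>b\<close> an upper bound.\<close>
  then obtain b where b: "b \<in> Field r" "\<And>k. k \<in> K \<Longrightarrow> b = k \<or> (b, k) \<notin> r"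
    unfolding cofinal_def by blast
  have "Well_order r"
    using assms(1) by (rule card_order_on_well_order_on)
  then have "(k, b) \<in> r" if "k \<in> K" for k
    using b that assms(3) wo_rel.TOTALS[of r]
    by (metis subsetD wo_rel_def)
  with b(1) show thesis by (rule that)
qed

text \<open>If no threshold \<open>N\<close> served every index, some index \<open>b N\<close> would
  defeat each \<open>N\<close>. These countably many indices have an upper bound \<open>u\<close> in
  \<open>\<sigma>\<close>; a threshold \<open>N\<close> for \<open>P u\<close> passes down to
  \<open>b N\<close> by \<open>mono\<close>, a contradiction.\<close>

lemma MOST_uniform:
  fixes P :: "'d \<Rightarrow> nat \<Rightarrow> bool"
  assumes "Card_order \<sigma>" "regularCard \<sigma>" "natLeq <o \<sigma>"
    and mono: "\<And>i j n. (i, j) \<in> \<sigma> \<Longrightarrow> P j n \<Longrightarrow> P i n"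
    and ev: "\<And>i. i \<in> Field \<sigma> \<Longrightarrow> \<forall>\<^sub>\<infinity>n. P i n"
  shows "\<forall>\<^sub>\<infinity>n. \<forall>i\<in>Field \<sigma>. P i n"
proof (rule ccontr)
  assume "\<not> ?thesis"
  then have "\<forall>N. \<exists>i\<in>Field \<sigma>. \<exists>n\<ge>N. \<not> P i n"
    unfolding MOST_nat_le by blast
  then obtain b where b: "\<And>N. b N \<in> Field \<sigma>" "\<And>N. \<exists>n\<ge>N. \<not> P (b N) n"
    by metis
  have "|range b| \<le>o natLeq"
    using card_of_image card_of_nat ordLeq_ordIso_trans by blast
  then have "|range b| <o \<sigma>"
    using assms(3) by (rule ordLeq_ordLess_trans)
  moreover have "range b \<subseteq> Field \<sigma>"
    using b(1) by blast
  ultimately obtain u where u: "u \<in> Field \<sigma>" "\<And>N. (b N, u) \<in> \<sigma>"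
    using regularCard_bounded[OF assms(1,2)] by (metis rangeI)
  obtain N where "\<forall>n\<ge>N. P u n"
    using ev[OF u(1)] unfolding MOST_nat_le by blast
  with b(2) mono[OF u(2)] show False by blast
qed

section \<open>Clubs in pointwise form\<close>

lemma cofinal_ord_rel:
  assumes "A \<subseteq> X"
  shows "cofinal A (ord_rel X) \<longleftrightarrow> (\<forall>a\<in>X. \<exists>b\<in>A. a < b)"
  unfolding cofinal_def Field_ord_rel using assms
  by (auto simp: ord_rel_def less_le subset_iff)

lemma club_iff:
  "club X E \<longleftrightarrow> E \<subseteq> X \<and> (\<forall>a\<in>X. \<exists>b\<in>E. a < b) \<and>
     (\<forall>\<alpha>\<in>X. {..<\<alpha>} \<noteq> {} \<and> (\<forall>a<\<alpha>. \<exists>b\<in>E. a < b \<and> b < \<alpha>) \<longrightarrow> \<alpha> \<in> E)"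
  unfolding club_def by (auto simp: cofinal_ord_rel Bex_def conj_commute conj_left_commute)

lemma finite_card_of_le: "Cinfinite \<mu> \<Longrightarrow> finite F \<Longrightarrow> |F| \<le>o \<mu>"
  by (intro ordLess_imp_ordLeq Cfinite_ordLess_Cinfinite)
    (auto simp: cfinite_def card_of_card_order_on Field_card_of)

section \<open>The local ideals\<close>

lemma ideal_on_I_at: "ideal_on (C \<delta>) (I_at pr c C \<delta>)"
  unfolding ideal_on_def
proof (intro conjI ballI allI impI)
  show "I_at pr c C \<delta> \<noteq> {}"
    by (force simp: I_at_def)
  show "I_at pr c C \<delta> \<subseteq> Pow (C \<delta>)"
    by (auto simp: I_at_def)
next
  fix A B
  assume "A \<in> I_at pr c C \<delta>" "B \<subseteq> A"
  then show "B \<in> I_at pr c C \<delta>"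
    unfolding I_at_def by (auto elim!: MOST_mono)
next
  fix A B
  assume "A \<in> I_at pr c C \<delta>" "B \<in> I_at pr c C \<delta>"
  then show "A \<union> B \<in> I_at pr c C \<delta>"
    unfolding I_at_def by (simp add: Int_Un_distrib2 MOST_conj_distrib)
qed

text \<open>The two nested quantifiers are made uniform one after the other: first the threshold for
  \<open>m\<close>, with "almost all \<open>n\<close>" kept inside the predicate, then, for each
  remaining \<open>m\<close>, the threshold for \<open>n\<close>. Missing a fixed interval passes to
  smaller sets, which gives the monotonicity both times.\<close>

lemma I_at_UN_chain:
  assumes \<sigma>: "Card_order \<sigma>" "regularCard \<sigma>" "natLeq <o \<sigma>"
    and chain: "relChain \<sigma> A" and A: "\<And>i. i \<in> Field \<sigma> \<Longrightarrow> A i \<in> I_at pr c C \<delta>"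
  shows "(\<Union>i\<in>Field \<sigma>. A i) \<in> I_at pr c C \<delta>"
proof -
  let ?X = "\<lambda>m n. nacc (C \<delta>) \<inter> Intv pr c \<delta> m n"
  have mono: "A j \<inter> ?X m n = {} \<Longrightarrow> A i \<inter> ?X m n = {}" if "(i, j) \<in> \<sigma>" for i j m n
    using chain that unfolding relChain_def by blast
  have "\<forall>\<^sub>\<infinity>m. \<forall>i\<in>Field \<sigma>. \<forall>\<^sub>\<infinity>n. A i \<inter> ?X m n = {}"
  proof (rule MOST_uniform[OF \<sigma>])
    show "\<forall>\<^sub>\<infinity>n. A i \<inter> ?X m n = {}" if "(i, j) \<in> \<sigma>" "\<forall>\<^sub>\<infinity>n. A j \<inter> ?X m n = {}" for i j m
      using that(2) mono[OF that(1)] by (rule MOST_mono)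
  qed (use A in \<open>auto simp: I_at_def Int_assoc\<close>)
  then have "\<forall>\<^sub>\<infinity>m. \<forall>\<^sub>\<infinity>n. \<forall>i\<in>Field \<sigma>. A i \<inter> ?X m n = {}"
    by (rule MOST_mono) (rule MOST_uniform[OF \<sigma>], use mono in blast, blast)
  then have "\<forall>\<^sub>\<infinity>m. \<forall>\<^sub>\<infinity>n. (\<Union>i\<in>Field \<sigma>. A i) \<inter> nacc (C \<delta>) \<inter> Intv pr c \<delta> m n = {}"
    by (elim MOST_mono) blast
  moreover have "(\<Union>i\<in>Field \<sigma>. A i) \<subseteq> C \<delta>"
    using A by (auto simp: I_at_def)
  ultimately show ?thesis
    by (simp add: I_at_def)
qed

lemma I_at_subset: "A \<in> I_at pr c C \<delta> \<Longrightarrow> B \<subseteq> A \<Longrightarrow> B \<in> I_at pr c C \<delta>"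
  using ideal_on_I_at[of C \<delta> pr c] unfolding ideal_on_def by blast

lemma I_at_Un: "A \<in> I_at pr c C \<delta> \<Longrightarrow> B \<in> I_at pr c C \<delta> \<Longrightarrow> A \<union> B \<in> I_at pr c C \<delta>"
  using ideal_on_I_at[of C \<delta> pr c] unfolding ideal_on_def by blast

section \<open>Non-stationary sets and properness of the global ideal\<close>

lemma nonstationary_in_I_global:
  assumes "\<not> stationary A"
  shows "A \<in> I_global pr S c C"
proof -
  \<comment> \<open>A club disjoint from \<open>A\<close> is itself the witness, because every trace
    of \<open>A\<close> on it is empty.\<close>
  obtain E where "club UNIV E" "A \<inter> E = {}"
    using assms unfolding stationary_def by blast
  moreover have "{} \<in> I_at pr c C \<delta>" for \<delta>
    by (simp add: I_at_def)
  ultimately show ?thesis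
    unfolding I_global_def by (auto intro!: exI[of _ E])
qed

text \<open>Guessing is applied to the very club \<open>E\<close> that would witness membership. The
  resulting stationary set meets \<open>E\<close> in some \<open>\<delta>\<close> where
  \<open>E\<close> hits every interval at points of \<open>nacc (C \<delta>)\<close>, whereas
  membership demands that almost all intervals be missed.\<close>

lemma UNIV_notin_I_global:
  assumes guess: "\<forall>E. club UNIV E \<longrightarrow>
    stationary {\<delta>\<in>S. \<forall>m n. E \<inter> nacc (C \<delta>) \<inter> Intv pr c \<delta> m n \<noteq> {}}"
  shows "UNIV \<notin> I_global pr S c C"
proof
  assume "UNIV \<in> I_global pr S c C"
  then obtain E where E: "club UNIV E" "\<And>\<delta>. \<delta> \<in> E \<inter> S \<Longrightarrow> E \<inter> C \<delta> \<in> I_at pr c C \<delta>"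
    unfolding I_global_def by auto
  obtain \<delta> where \<delta>: "\<delta> \<in> E" "\<delta> \<in> S" "\<And>m n. E \<inter> nacc (C \<delta>) \<inter> Intv pr c \<delta> m n \<noteq> {}"
    using guess E(1) unfolding stationary_def by blast
  have "E \<inter> C \<delta> \<inter> nacc (C \<delta>) = E \<inter> nacc (C \<delta>)"
    by (auto simp: nacc_def)
  with E(2)[of \<delta>] \<delta> show False
    by (simp add: I_at_def)
qed

section \<open>Bounded sets and intersections of clubs in \<open>\<mu>\<^sup>+\<close>\<close>

context
  fixes \<mu> :: "'b rel"
  assumes mu_inf: "Cinfinite \<mu>"
    and mu_plus: "ord_rel (UNIV :: 'a::wellorder set) =o cardSuc \<mu>"
begin

lemma Card_order_ord_rel_UNIV: "Card_order (ord_rel (UNIV :: 'a set))"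
  using mu_inf mu_plus Card_order_ordIso cardSuc_Card_order by blast

lemma ord_rel_UNIV_strictly_bounded:
  fixes A :: "'a set"
  assumes "|A| \<le>o \<mu>"
  shows "\<exists>b. \<forall>a\<in>A. a < b"
proof -
  have inf: "Cinfinite (ord_rel (UNIV :: 'a set))"
    using Cinfinite_cardSuc[OF mu_inf] mu_plus Cinfinite_cong ordIso_symmetric by blast
  have "regularCard (ord_rel (UNIV :: 'a set))"
    using regularCard_cardSuc[OF mu_inf] Cinfinite_cardSuc[OF mu_inf] mu_plus
      regularCard_ordIso ordIso_symmetric by blast
  moreover have "|A| <o ord_rel (UNIV :: 'a set)"
    using assms cardSuc_greater mu_inf mu_plus
    by (meson ordIso_symmetric ordLeq_ordLess_trans ordLess_ordIso_trans)
  ultimately obtain b where b: "\<And>a. a \<in> A \<Longrightarrow> (a, b) \<in> ord_rel UNIV"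
    using regularCard_bounded[OF Card_order_ord_rel_UNIV, of A] by auto
  \<comment> \<open>Regularity yields only a non-strict bound; an infinite cardinal has no largest
    element, so a point above \<open>b\<close> makes it strict.\<close>
  obtain b' where "b \<noteq> b'" "(b, b') \<in> ord_rel UNIV"
    using infinite_Card_order_limit[of "ord_rel (UNIV :: 'a set)" b] inf
    by (auto simp: cinfinite_def)
  with b show ?thesis
    by (intro exI[of _ b']) (fastforce simp: ord_rel_def)
qed

text \<open>Closedness is inherited from the members. For unboundedness, a function \<open>f\<close>
  leaves room for a point of every member between \<open>x\<close> and \<open>f x\<close>; the
  supremum of the iterates of \<open>f\<close> is then a limit of points of each member.\<close>

lemma club_Inter:
  fixes \<E> :: "'a set set"
  assumes card: "|\<E>| \<le>o \<mu>" and club: "\<And>E. E \<in> \<E> \<Longrightarrow> club UNIV E"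
  shows "club UNIV (\<Inter>\<E>)"
  unfolding club_iff
proof (intro conjI ballI impI)
  fix a :: 'a
  \<comment> \<open>One point above \<open>x\<close> is picked in each member; these at most
    \<open>\<mu>\<close> many points have a common strict bound.\<close>
  have "\<exists>y. \<forall>E\<in>\<E>. \<exists>e\<in>E. x < e \<and> e < y" for x :: 'a
  proof -
    have "\<forall>E\<in>\<E>. \<exists>e\<in>E. x < e"
      using club unfolding club_iff by blast
    then obtain g where g: "\<And>E. E \<in> \<E> \<Longrightarrow> g E \<in> E \<and> x < g E"
      by metis
    have "|g ` \<E>| \<le>o \<mu>"
      using card_of_image card by (rule ordLeq_transitive)
    from ord_rel_UNIV_strictly_bounded[OF this] g show ?thesis by blast
  qed
  then obtain f where f: "\<And>x E. E \<in> \<E> \<Longrightarrow> \<exists>e\<in>E. x < e \<and> e < f x"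
    by metis
  show "\<exists>b\<in>\<Inter>\<E>. a < b"
  proof -
    define x where "x n = (f ^^ n) a" for n
    have x_Suc: "x (Suc n) = f (x n)" and x_0: "x 0 = a" for n
      by (simp_all add: x_def)
    have "|range x| \<le>o natLeq"
      using card_of_image card_of_nat ordLeq_ordIso_trans by blast
    moreover have "natLeq \<le>o \<mu>"
      using mu_inf natLeq_ordLeq_cinfinite by blast
    ultimately have "|range x| \<le>o \<mu>"
      by (rule ordLeq_transitive)
    then have bdd: "\<exists>b. \<forall>n. x n < b"
      using ord_rel_UNIV_strictly_bounded by blast
    \<comment> \<open>As least strict upper bound, \<open>\<alpha>\<close> has iterates at or above
      each smaller \<open>y\<close> even if \<open>x\<close> is not increasing. This matters for the
      empty family, where \<open>f\<close> is arbitrary.\<close>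
    define \<alpha> where "\<alpha> = (LEAST b. \<forall>n. x n < b)"
    have above: "x n < \<alpha>" for n
      using LeastI_ex[OF bdd] unfolding \<alpha>_def by blast
    have least: "\<exists>n. y \<le> x n" if "y < \<alpha>" for y
      using not_less_Least[of y "\<lambda>b. \<forall>n. x n < b"] that unfolding \<alpha>_def
      by (meson not_less)
    have "\<alpha> \<in> E" if "E \<in> \<E>" for E
    proof -
      have "\<exists>b\<in>E. y < b \<and> b < \<alpha>" if "y < \<alpha>" for y
      proof -
        obtain n where "y \<le> x n"
          using least \<open>y < \<alpha>\<close> by blast
        moreover obtain e where "e \<in> E" "x n < e" "e < x (Suc n)"
          using f[OF \<open>E \<in> \<E>\<close>, of "x n"] unfolding x_Suc by blast
        ultimately show ?thesis
          using above[of "Suc n"] by (meson le_less_trans less_trans)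
      qed
      \<comment> \<open>This excludes the least ordinal, for which the limit condition is
        vacuous.\<close>
      moreover have "{..<\<alpha>} \<noteq> {}"
        using above by blast
      ultimately show ?thesis
        using club[OF that] unfolding club_iff by blast
    qed
    with above[of 0] x_0 show ?thesis by auto
  qed
next
  fix \<alpha> :: 'a
  assume \<alpha>: "{..<\<alpha>} \<noteq> {} \<and> (\<forall>a<\<alpha>. \<exists>b\<in>\<Inter>\<E>. a < b \<and> b < \<alpha>)"
  show "\<alpha> \<in> \<Inter>\<E>"
  proof
    fix E assume "E \<in> \<E>"
    then have "\<forall>a<\<alpha>. \<exists>b\<in>E. a < b \<and> b < \<alpha>"
      using \<alpha> by (meson InterD)
    with \<alpha> club[OF \<open>E \<in> \<E>\<close>] show "\<alpha> \<in> E"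
      unfolding club_iff by simp
  qed
qed simp

lemma club_Int:
  fixes E :: "'a set"
  assumes "club UNIV E" "club UNIV E'"
  shows "club UNIV (E \<inter> E')"
  using club_Inter[of "{E, E'}"] assms finite_card_of_le[OF mu_inf, of "{E, E'}"] by auto

section \<open>Ideal laws and indecomposability of the global ideal\<close>

lemma ideal_on_I_global: "ideal_on UNIV (I_global pr (S :: 'a set) c C)"
  unfolding ideal_on_def
proof (intro conjI ballI allI impI)
  have "{} \<in> I_global pr S c C"
    \<comment> \<open>The intersection of the empty family is \<open>UNIV\<close>, so a club exists
      and the empty set is non-stationary.\<close>
    using club_Inter[of "{}"] finite_card_of_le[OF mu_inf, of "{}"]
    by (intro nonstationary_in_I_global) (auto simp: stationary_def)
  then show "I_global pr S c C \<noteq> {}"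
    by blast
next
  fix A B
  assume "A \<in> I_global pr S c C" "B \<subseteq> A"
  then obtain E where E: "club UNIV E" "\<And>\<delta>. \<delta> \<in> E \<inter> S \<Longrightarrow> A \<inter> E \<inter> C \<delta> \<in> I_at pr c C \<delta>"
    unfolding I_global_def by auto
  have "B \<inter> E \<inter> C \<delta> \<in> I_at pr c C \<delta>" if "\<delta> \<in> E \<inter> S" for \<delta>
    by (rule I_at_subset[OF E(2)[OF that]]) (use \<open>B \<subseteq> A\<close> in blast)
  with E(1) show "B \<in> I_global pr S c C"
    unfolding I_global_def by blast
next
  fix A B
  assume "A \<in> I_global pr S c C" "B \<in> I_global pr S c C"
  then obtain E E' where
    E: "club UNIV E" "\<And>\<delta>. \<delta> \<in> E \<inter> S \<Longrightarrow> A \<inter> E \<inter> C \<delta> \<in> I_at pr c C \<delta>" and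
    E': "club UNIV E'" "\<And>\<delta>. \<delta> \<in> E' \<inter> S \<Longrightarrow> B \<inter> E' \<inter> C \<delta> \<in> I_at pr c C \<delta>"
    unfolding I_global_def by blast
  \<comment> \<open>Shrinking a club only shrinks traces, so the trace on the common club lies
    inside the union of the two given traces.\<close>
  have "(A \<union> B) \<inter> (E \<inter> E') \<inter> C \<delta> \<in> I_at pr c C \<delta>" if "\<delta> \<in> E \<inter> E' \<inter> S" for \<delta>
    by (rule I_at_subset[OF I_at_Un[OF E(2) E'(2)]]) (use that in auto)
  moreover have "club UNIV (E \<inter> E')"
    using club_Int E(1) E'(1) .
  ultimately show "A \<union> B \<in> I_global pr S c C"
    unfolding I_global_def by blast
qed simp

text \<open>The bound on \<open>\<sigma>\<close> limits the number of witnessing clubs, so that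
  their intersection is a club; regularity and uncountability enter through
  \<open>I_at_UN_chain\<close>.\<close>

lemma indecomposable_I_global:
  assumes \<sigma>: "Card_order \<sigma>" "regularCard \<sigma>" "natLeq <o \<sigma>" and le: "\<sigma> \<le>o \<mu>"
  shows "indecomposable \<sigma> (I_global pr (S :: 'a set) c C)"
  unfolding indecomposable_def
proof (intro allI impI, elim conjE)
  fix A
  assume chain: "relChain \<sigma> A" and A: "\<forall>i\<in>Field \<sigma>. A i \<in> I_global pr S c C"
  then obtain E where E: "\<And>i. i \<in> Field \<sigma> \<Longrightarrow> club UNIV (E i)"
    "\<And>i \<delta>. i \<in> Field \<sigma> \<Longrightarrow> \<delta> \<in> E i \<inter> S \<Longrightarrow> A i \<inter> E i \<inter> C \<delta> \<in> I_at pr c C \<delta>"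
    unfolding I_global_def mem_Collect_eq by metis
  let ?E = "\<Inter>i\<in>Field \<sigma>. E i"
  have "|E ` Field \<sigma>| \<le>o \<mu>"
    using card_of_image card_of_Field_ordIso[OF \<sigma>(1)] le
    by (meson ordIso_ordLeq_trans ordLeq_transitive)
  then have "club UNIV ?E"
    by (rule club_Inter) (use E(1) in blast)
  moreover have "(\<Union>i\<in>Field \<sigma>. A i) \<inter> ?E \<inter> C \<delta> \<in> I_at pr c C \<delta>" if "\<delta> \<in> ?E \<inter> S" for \<delta>
  proof -
    \<comment> \<open>The sets \<open>A i \<inter> E i\<close> need not increase with
      \<open>i\<close>, as the clubs vary. Cutting every \<open>A i\<close> by the same
      \<open>?E\<close> keeps the chain increasing, and each new trace is a subset of the old
      one.\<close>
    have "(\<Union>i\<in>Field \<sigma>. A i \<inter> ?E \<inter> C \<delta>) \<in> I_at pr c C \<delta>"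
    proof (rule I_at_UN_chain[OF \<sigma>])
      show "relChain \<sigma> (\<lambda>i. A i \<inter> ?E \<inter> C \<delta>)"
        using chain unfolding relChain_def by blast
      show "A i \<inter> ?E \<inter> C \<delta> \<in> I_at pr c C \<delta>" if "i \<in> Field \<sigma>" for i
        by (rule I_at_subset[OF E(2)[OF that]]) (use that \<open>\<delta> \<in> ?E \<inter> S\<close> in auto)
    qed
    then show ?thesis
      by (simp only: Int_UN_distrib2 UN_extend_simps(4) Int_assoc)
  qed
  ultimately show "(\<Union>i\<in>Field \<sigma>. A i) \<in> I_global pr S c C"
    unfolding I_global_def by blast
qed

end

theorem theorem2p5:
  fixes \<mu> :: "'b rel"
    and \<mu>s :: "nat \<Rightarrow> 'b rel"
    and S :: "'a::wellorder set"
    and c :: "'a \<Rightarrow> nat \<Rightarrow> 'a"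
    and pr :: "nat \<times> nat \<Rightarrow> nat"
    and C :: "'a \<Rightarrow> 'a set"
  assumes mu_singular: "Cinfinite \<mu>" "\<not> regularCard \<mu>"
    and mu_cof: "cofinality \<mu> =o natLeq"
    and mu_plus: "ord_rel (UNIV :: 'a set) =o cardSuc \<mu>"
    and S_stat: "stationary S"
    and S_cof: "\<forall>\<delta>\<in>S. cofinality (ord_rel {..<\<delta>}) =o natLeq"
    and c_cof: "\<forall>\<delta>\<in>S. strict_mono (c \<delta>) \<and> range (c \<delta>) \<subseteq> {..<\<delta>}
                  \<and> cofinal (range (c \<delta>)) (ord_rel {..<\<delta>})"
    and c_guess: "\<forall>E. club UNIV E \<longrightarrow> stationary {\<delta>\<in>S. \<forall>n. c \<delta> n \<in> E}"
    and mus_regular: "\<forall>m. Cinfinite (\<mu>s m) \<and> regularCard (\<mu>s m)"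
    and mus_increasing: "\<forall>m n. m < n \<longrightarrow> \<mu>s m <o \<mu>s n"
    and mus_cofinal: "\<forall>m. \<mu>s m <o \<mu>"
                     "\<forall>\<kappa> :: 'b rel. Card_order \<kappa> \<and> \<kappa> <o \<mu> \<longrightarrow> (\<exists>m. \<kappa> \<le>o \<mu>s m)"
    and pr_bij: "bij pr"
    and pr_mono: "\<forall>n. strict_mono (\<lambda>m. pr (m, n))" "\<forall>m. strict_mono (\<lambda>n. pr (m, n))"
    and C_club: "\<forall>\<delta>\<in>S. club {..<\<delta>} (C \<delta>)"
    and C_ran: "\<forall>\<delta>\<in>S. range (c \<delta>) \<subseteq> C \<delta>"
    and C_small: "\<forall>\<delta>\<in>S. \<forall>m n.
                    |C \<delta> \<inter> {c \<delta> (pr (m, n)) <.. c \<delta> (pr (m, n) + 1)}| \<le>o \<mu>s m"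
    and C_nacc: "\<forall>\<delta>\<in>S. \<forall>m n. \<forall>\<alpha>\<in>nacc (C \<delta>) \<inter> Intv pr c \<delta> m n.
                    \<mu>s m <o cofinality (ord_rel {..<\<alpha>})"
    and C_guess: "\<forall>E. club UNIV E \<longrightarrow>
                    stationary {\<delta>\<in>S. \<forall>m n. E \<inter> nacc (C \<delta>) \<inter> Intv pr c \<delta> m n \<noteq> {}}"
  shows "(\<forall>\<delta>\<in>S. ideal_on (C \<delta>) (I_at pr c C \<delta>)
            \<and> (\<forall>\<sigma> :: 'd rel. Card_order \<sigma> \<and> regularCard \<sigma> \<and> natLeq <o \<sigma>
                  \<longrightarrow> indecomposable \<sigma> (I_at pr c C \<delta>)))
       \<and> (ideal_on UNIV (I_global pr S c C)
            \<and> UNIV \<notin> I_global pr S c C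
            \<and> (\<forall>A. \<not> stationary A \<longrightarrow> A \<in> I_global pr S c C)
            \<and> (\<forall>\<sigma> :: 'd rel. Card_order \<sigma> \<and> regularCard \<sigma> \<and> natLeq <o \<sigma> \<and> \<sigma> <o \<mu>
                  \<longrightarrow> indecomposable \<sigma> (I_global pr S c C)))"
proof (intro conjI ballI allI impI)
  show "ideal_on (C \<delta>) (I_at pr c C \<delta>)" for \<delta>
    by (rule ideal_on_I_at)
  show "indecomposable \<sigma> (I_at pr c C \<delta>)"
    if "Card_order \<sigma> \<and> regularCard \<sigma> \<and> natLeq <o \<sigma>" for \<sigma> :: "'d rel" and \<delta>
    using that I_at_UN_chain unfolding indecomposable_def by blast
  show "ideal_on UNIV (I_global pr S c C)"
    by (rule ideal_on_I_global[OF mu_singular(1) mu_plus])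
  show "UNIV \<notin> I_global pr S c C"
    using C_guess by (rule UNIV_notin_I_global)
  show "A \<in> I_global pr S c C" if "\<not> stationary A" for A
    using that by (rule nonstationary_in_I_global)
  show "indecomposable \<sigma> (I_global pr S c C)"
    if "Card_order \<sigma> \<and> regularCard \<sigma> \<and> natLeq <o \<sigma> \<and> \<sigma> <o \<mu>" for \<sigma> :: "'d rel"
    using that indecomposable_I_global[OF mu_singular(1) mu_plus] ordLess_imp_ordLeq by blast
qed

end
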